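(* Let $n\ge 2$ be an integer and let $k\in\{1,2,\ldots,n-1\}$ with $k\ne n/2$. Then $$ \ln\Gamma\!\left(\frac kn\right)=\frac{(n-2k)\ln2\pi}{2n}+\frac12\left\{\ln\pi-\ln\sin\frac{\pi k}{n}\right\}+\frac1\pi\sum_{r=1}^{n-1}\frac{\gamma+\ln r}{r}\cdot\sin\frac{2\pi rk}{n}-\frac1{2\pi}\sin\frac{2\pi k}{n}\cdot\int_0^\infty\frac{e^{-nx}\ln x}{\cosh x-\cos\frac{2\pi k}{n}}\,dx . $$
   Context: $\gamma$ is Euler's constant, $\Gamma$ the Gamma function, and $\ln 2\pi=\ln(2\pi)$. *)

theory Defs
  imports "HOL-Analysis.Analysis"
begin

end

theory Submission
  imports Defs "HOL-Real_Asymp.Real_Asymp"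
begin

text \<open>
  With \<open>x = k / n\<close> and \<open>\<theta> = 2 \<pi> x\<close>, the kernel \<open>sin \<theta> / (cosh t - cos \<theta>)\<close> is
  the geometric series \<open>2 \<Sum>r\<ge>1. exp (-r t) sin (r \<theta>)\<close>; since \<open>n \<theta>\<close> is a multiple of \<open>2 \<pi>\<close>, its
  tail from \<open>r = n\<close> on is \<open>exp (-n t)\<close> times the kernel. As \<open>\<integral> exp (-r t) ln t = -(\<gamma> + ln r) / r\<close>,
  the theorem reduces to the integral of the kernel against \<open>ln t\<close> (Malmsten).

  That integral follows from the partial fraction expansion of the kernel, which is the real part of
  \<open>\<pi> cot (\<pi> z) = \<psi> (1 - z) - \<psi> z\<close> at \<open>z = x + i t / (2 \<pi>)\<close>: the terms are Lorentzians
  \<open>a / (t\<^sup>2 + a\<^sup>2)\<close> with \<open>a = 2 \<pi> (m + x)\<close> and \<open>a = 2 \<pi> (m + 1 - x)\<close>, whose integrals against \<open>ln t\<close> are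
  \<open>(\<pi> / 2) ln a\<close>, so the partial sums produce Gauss's product for \<open>\<Gamma> (1 - x) / \<Gamma> x\<close>. Summing and
  integrating do not commute as they stand; adding the vanishing Lorentzian
  \<open>(1 - 2 x) a / (t\<^sup>2 + a\<^sup>2)\<close>, \<open>a = 2 \<pi> M\<close>, to the \<open>M\<close>-th partial sum turns its increments into second
  differences, which are dominated.
\<close>

section \<open>Lorentzians against the logarithm\<close>

text \<open>This is the real part of \<open>1 / Complex a t\<close>, which is how Lorentzians are
  later read off from sums of inverses of complex numbers.\<close>

definition lorentz :: "real \<Rightarrow> real \<Rightarrow> real" where
  "lorentz a t = a / (t\<^sup>2 + a\<^sup>2)"

text \<open>Apply \<open>ln s \<le> s - 1\<close> to \<open>s = t powr (-1/2)\<close> near 0 and to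
  \<open>s = t powr (1/4)\<close> beyond 1. The resulting exponents -1/2 > -1 and -5/4 < -1 are
  integrable at their respective ends.\<close>

lemma abs_ln_le_powr:
  fixes t :: real
  assumes "t > 0"
  shows "\<bar>ln t\<bar> * max 1 t powr (-3/2) \<le> 4 * (if t \<le> 1 then t powr (-1/2) else t powr (-5/4))"
proof (cases "t \<le> 1")
  case True
  have "ln (t powr (-1/2)) \<le> t powr (-1/2) - 1"
    using assms by (intro ln_le_minus_one) auto
  hence "- ln t \<le> 2 * t powr (-1/2)"
    using assms by (simp add: ln_powr)
  moreover have "ln t \<le> 0" using True assms by simp
  moreover have "0 \<le> t powr (-1/2)" by simp
  ultimately have "\<bar>ln t\<bar> \<le> 4 * t powr (-1/2)" by linarith
  thus ?thesis using True by (simp add: max_def)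
next
  case False
  have "ln (t powr (1/4)) \<le> t powr (1/4) - 1"
    using assms by (intro ln_le_minus_one) auto
  hence "ln t \<le> 4 * t powr (1/4)"
    using assms by (simp add: ln_powr)
  moreover have "ln t \<ge> 0" using False by simp
  ultimately have "\<bar>ln t\<bar> * t powr (-3/2) \<le> 4 * t powr (1/4) * t powr (-3/2)"
    by (intro mult_right_mono) auto
  also have "\<dots> = 4 * t powr (-5/4)"
    by (simp flip: powr_add)
  finally show ?thesis using False by (simp add: max_def)
qed

lemma powr_majorant_integrable:
  "(\<lambda>t::real. if t \<le> 1 then t powr (-1/2) else t powr (-5/4)) integrable_on {0<..}"
proof -
  let ?g = "\<lambda>t::real. if t \<le> 1 then t powr (-1/2) else t powr (-5/4)"
  have 1: "?g integrable_on {0<..1}"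
    by (rule integrable_eq[OF integrable_on_powr_from_0'[of "-1/2" 1]]) auto
  have "((\<lambda>t::real. t powr (-5/4)) has_integral -(1 powr (-5/4 + 1)) / (-5/4 + 1)) {1..}"
    by (rule has_integral_powr_to_inf) auto
  hence 2: "?g integrable_on {1..}"
    by (intro integrable_spike_finite[of "{1}" _ ?g "\<lambda>t. t powr (-5/4)"]) (auto simp: integrable_on_def)
  have "?g integrable_on {0<..1} \<union> {1..}"
    by (rule integrable_Un'[OF 1 2]) (auto intro: negligible_subset[of "{1}"])
  also have "{0<..1} \<union> {1..} = {0::real<..}" by auto
  finally show ?thesis .
qed

text \<open>The common integrability criterion. The exponent -3/2 is the one obtained in
  \<open>S_step_le\<close>, where cubic decay is shared evenly between the summation index and
  \<open>t\<close>.\<close>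

lemma ln_mult_absolutely_integrable:
  fixes g :: "real \<Rightarrow> real"
  assumes "continuous_on {0<..} g" and "\<And>t. t > 0 \<Longrightarrow> \<bar>g t\<bar> \<le> C * max 1 t powr (-3/2)"
  shows "(\<lambda>t. g t * ln t) absolutely_integrable_on {0<..}"
proof (rule measurable_bounded_by_integrable_imp_absolutely_integrable)
  show "(\<lambda>t. g t * ln t) \<in> borel_measurable (lebesgue_on {0<..})"
    using assms(1)
    by (intro continuous_imp_measurable_on_sets_lebesgue continuous_intros) auto
  show "(\<lambda>t. C * (4 * (if t \<le> 1 then t powr (-1/2) else t powr (-5/4)))) integrable_on {0::real<..}"
    using powr_majorant_integrable by (intro integrable_on_mult_right) 
  fix t :: real assume "t \<in> {0<..}"
  hence t: "t > 0" by simp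
  \<comment> \<open>The sign of \<open>C\<close> is not assumed; the bound at the point
    \<open>t\<close> forces it.\<close>
  have "0 \<le> C * max 1 t powr (-3/2)" using assms(2)[OF t] by linarith
  hence C: "0 \<le> C" using t by (simp add: zero_le_mult_iff max_def split: if_splits)
  have "norm (g t * ln t) \<le> C * max 1 t powr (-3/2) * \<bar>ln t\<bar>"
    using assms(2)[OF t] by (simp add: abs_mult mult_right_mono)
  also have "\<dots> = C * (\<bar>ln t\<bar> * max 1 t powr (-3/2))" by (simp add: algebra_simps)
  also have "\<dots> \<le> C * (4 * (if t \<le> 1 then t powr (-1/2) else t powr (-5/4)))"
    using abs_ln_le_powr[OF t] C by (intro mult_left_mono)
  finally show "norm (g t * ln t) \<le> C * (4 * (if t \<le> 1 then t powr (-1/2) else t powr (-5/4)))" .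
qed auto

section \<open>Changes of variables on the half-line, and the integral of a Lorentzian against
  \<open>ln\<close>\<close>

lemma image_scale_Ioi:
  fixes a :: real
  assumes "a > 0"
  shows "(*) a ` {0<..} = {0<..}"
proof -
  have "t \<in> (*) a ` {0<..}" if "t > 0" for t
    using that assms by (intro image_eqI[of _ _ "t / a"]) auto
  thus ?thesis using assms by auto
qed

lemma image_inverse_Ioi: "inverse ` {0<..} = {0::real<..}"
proof -
  have "t \<in> inverse ` {0<..}" if "t > 0" for t :: real
    using that by (intro image_eqI[of _ _ "inverse t"]) auto
  thus ?thesis by auto
qed

lemma has_absolute_integral_scale_Ioi:
  fixes f :: "real \<Rightarrow> real"
  assumes "a > 0"
  shows "(\<lambda>x. a * f (a * x)) absolutely_integrable_on {0<..} \<and>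
           integral {0<..} (\<lambda>x. a * f (a * x)) = b \<longleftrightarrow>
         f absolutely_integrable_on {0<..} \<and> integral {0<..} f = b"
proof -
  have "(\<lambda>x. \<bar>a\<bar> * f (a * x)) absolutely_integrable_on {0<..} \<and>
           integral {0<..} (\<lambda>x. \<bar>a\<bar> * f (a * x)) = b \<longleftrightarrow>
         f absolutely_integrable_on (*) a ` {0<..} \<and> integral ((*) a ` {0<..}) f = b"
    by (rule has_absolute_integral_change_of_variables_1'[where g' = "\<lambda>_. a"])
      (use assms in \<open>auto intro!: derivative_eq_intros inj_onI\<close>)
  thus ?thesis using assms by (simp add: image_scale_Ioi)
qed

lemma continuous_on_lorentz:
  assumes "a > 0"
  shows "continuous_on A (lorentz a)"
  unfolding lorentz_def using assms
  by (intro continuous_intros) (auto simp: add_nonneg_eq_0_iff)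

lemma lorentz_nonneg: "a \<ge> 0 \<Longrightarrow> lorentz a t \<ge> 0"
  by (simp add: lorentz_def)

lemma lorentz_le:
  assumes "a > 0" and t: "t > 0"
  shows "lorentz a t \<le> (a + 1 / a) * max 1 t powr (-3/2)"
proof (cases "t \<le> 1")
  case True
  have "lorentz a t \<le> a / a\<^sup>2" unfolding lorentz_def
    using assms by (intro divide_left_mono) (auto simp: add_nonneg_pos)
  also have "\<dots> = 1 / a" using assms by (simp add: power2_eq_square)
  finally show ?thesis using True assms by (simp add: max.absorb1)
next
  case False
  have "lorentz a t \<le> a / t\<^sup>2" unfolding lorentz_def using assms t
    by (intro divide_left_mono) (auto simp: add_nonneg_pos add_pos_nonneg)
  also have "\<dots> = a * t powr (-2)" using t by (simp add: powr_minus divide_inverse)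
  also have "\<dots> \<le> (a + 1 / a) * t powr (-3/2)"
    using assms False by (intro mult_mono powr_mono) auto
  finally show ?thesis using False assms by (simp add: max.absorb2)
qed

lemma lorentz_ln_absolutely_integrable:
  assumes "a > 0"
  shows "(\<lambda>t. lorentz a t * ln t) absolutely_integrable_on {0<..}"
  using assms
  by (intro ln_mult_absolutely_integrable[where C = "a + 1 / a"] continuous_on_lorentz)
    (use lorentz_le[OF assms] assms in \<open>auto simp: lorentz_nonneg\<close>)

text \<open>The substitution \<open>t = 1 / x\<close> preserves the measure
  \<open>dt / (t^2 + 1)\<close> and changes the sign of \<open>ln\<close>, so the integral equals
  its own negative.\<close>

lemma integral_lorentz_1_ln: "integral {0<..} (\<lambda>t::real. 1 / (t\<^sup>2 + 1) * ln t) = 0"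
proof -
  let ?f = "\<lambda>t::real. 1 / (t\<^sup>2 + 1) * ln t"
  have ai: "?f absolutely_integrable_on {0<..}" using lorentz_ln_absolutely_integrable[of 1] by (simp add: lorentz_def)
  have "(\<lambda>x. \<bar>- inverse (x^2)\<bar> * ?f (inverse x)) absolutely_integrable_on {0<..} \<and>
           integral {0<..} (\<lambda>x. \<bar>- inverse (x^2)\<bar> * ?f (inverse x)) = integral {0<..} ?f \<longleftrightarrow>
         ?f absolutely_integrable_on inverse ` {0<..} \<and> integral (inverse ` {0<..}) ?f = integral {0<..} ?f"
    by (rule has_absolute_integral_change_of_variables_1')
      (auto intro!: derivative_eq_intros inj_onI simp: power2_eq_square)
  hence "integral {0<..} (\<lambda>x. \<bar>- inverse (x^2)\<bar> * ?f (inverse x)) = integral {0<..} ?f"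
    using ai by (simp add: image_inverse_Ioi)
  moreover have "integral {0<..} (\<lambda>x. \<bar>- inverse (x^2)\<bar> * ?f (inverse x)) = integral {0<..} (\<lambda>x. - ?f x)"
    by (rule integral_cong) (auto simp: ln_inverse ln_div field_simps)
  ultimately show ?thesis by simp
qed

lemma inverse_one_plus_square_has_integral:
  "((\<lambda>t::real. 1 / (t\<^sup>2 + 1)) has_integral pi / 2) {0<..}"
proof -
  have *: "((\<lambda>t::real. 1 / (t\<^sup>2 + 1)) has_integral arctan y) {0..y}" if "y \<ge> 0" for y
  proof -
    have "((\<lambda>t::real. 1 / (t\<^sup>2 + 1)) has_integral arctan y - arctan 0) {0..y}"
      using that by (intro fundamental_theorem_of_calculus)
        (auto intro!: derivative_eq_intros simp: field_simps
              simp flip: has_real_derivative_iff_has_vector_derivative)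
    thus ?thesis by simp
  qed
  have "((\<lambda>t::real. 1 / (t\<^sup>2 + 1)) has_integral pi / 2) {0..}"
  proof (rule has_integral_to_inf)
    show "(\<lambda>t::real. 1 / (t\<^sup>2 + 1)) integrable_on {0..y}" for y
      by (intro integrable_continuous_interval continuous_intros) (auto simp: add_nonneg_eq_0_iff)
    have "eventually (\<lambda>y. arctan y = integral {0..y} (\<lambda>t. 1 / (t\<^sup>2 + 1))) at_top"
      using eventually_ge_at_top[of 0] by eventually_elim (simp add: integral_unique[OF *])
    thus "((\<lambda>y. integral {0..y} (\<lambda>t. 1 / (t\<^sup>2 + 1))) \<longlongrightarrow> pi / 2) at_top"
      by (rule Lim_transform_eventually[OF tendsto_arctan_at_top])
  qed auto
  thus ?thesis
    by (rule has_integral_spike_set_eq[THEN iffD1, rotated -1]) (auto intro: negligible_subset[of "{0}"])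
qed

text \<open>Scaling \<open>t\<close> by \<open>a\<close> reduces to \<open>a = 1\<close> and splits
  \<open>ln (a * t)\<close> into \<open>ln a + ln t\<close>: the first summand meets the total mass
  \<open>pi / 2\<close>, the second integrates to 0.\<close>

lemma lorentz_ln_has_integral:
  fixes a :: real
  assumes "a > 0"
  shows "((\<lambda>t. lorentz a t * ln t) has_integral pi / 2 * ln a) {0<..}"
proof -
  let ?f = "\<lambda>t. a / (t\<^sup>2 + a\<^sup>2) * ln t"
  have 1: "((\<lambda>t::real. 1 / (t\<^sup>2 + 1) * ln t) has_integral 0) {0<..}"
    using lorentz_ln_absolutely_integrable[of 1] integral_lorentz_1_ln
    by (simp add: lorentz_def has_integral_iff absolutely_integrable_on_def)
  have "((\<lambda>t. ln a * (1 / (t\<^sup>2 + 1)) + 1 / (t\<^sup>2 + 1) * ln t) has_integral ln a * (pi / 2) + 0) {0<..}"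
    by (intro has_integral_add has_integral_mult_right inverse_one_plus_square_has_integral 1)
  moreover have eq: "ln a * (1 / (t\<^sup>2 + 1)) + 1 / (t\<^sup>2 + 1) * ln t = a * ?f (a * t)" if "t > 0" for t
  proof -
    have "(a * t)\<^sup>2 + a\<^sup>2 = a\<^sup>2 * (t\<^sup>2 + 1)" by (simp add: power_mult_distrib algebra_simps)
    hence "a * (a / ((a * t)\<^sup>2 + a\<^sup>2)) = 1 / (t\<^sup>2 + 1)" using assms by (simp add: power2_eq_square)
    hence "a * ?f (a * t) = 1 / (t\<^sup>2 + 1) * ln (a * t)" by (metis mult.assoc)
    thus ?thesis using assms that by (simp add: ln_mult add_divide_distrib)
  qed
  ultimately have "((\<lambda>t. a * ?f (a * t)) has_integral ln a * (pi / 2) + 0) {0<..}"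
    by (subst has_integral_cong[OF eq[symmetric]]) auto
  hence "integral {0<..} (\<lambda>t. a * ?f (a * t)) = pi / 2 * ln a"
    by (simp only: integral_unique mult.commute add_0_right)
  moreover have ai: "?f absolutely_integrable_on {0<..}"
    using lorentz_ln_absolutely_integrable[OF assms] by (simp add: lorentz_def)
  moreover have "integral {0<..} (\<lambda>t. a * ?f (a * t)) = integral {0<..} ?f"
    using iffD2[OF has_absolute_integral_scale_Ioi[OF assms] conjI[OF ai refl]] by (rule conjunct2)
  ultimately have "(?f has_integral pi / 2 * ln a) {0<..}"
    by (simp only: has_integral_iff absolutely_integrable_on_def)
  thus ?thesis by (simp only: lorentz_def)
qed

section \<open>Partial fractions of the kernel\<close>

text \<open>By reflection the sine is a multiple of \<open>rGamma z * rGamma (1 - z)\<close>, and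
  \<open>rGamma\<close> vanishes only at nonpositive integers.\<close>

lemma sin_pi_times_nonzero:
  fixes z :: complex
  assumes "z \<notin> \<int>"
  shows "sin (of_real pi * z) \<noteq> 0"
proof -
  have "z \<notin> \<int>\<^sub>\<le>\<^sub>0" "1 - z \<notin> \<int>\<^sub>\<le>\<^sub>0"
    using assms nonpos_Ints_Int Ints_diff[of 1 "1 - z"] by auto
  thus ?thesis using rGamma_reflection_complex[of z] by (auto simp: rGamma_eq_zero_iff)
qed

text \<open>The logarithmic derivative of the reflection formula: both sides of the formula for
  \<open>rGamma\<close> are differentiated and the derivatives compared.\<close>

lemma Digamma_reflection_complex:
  fixes z :: complex
  assumes "z \<notin> \<int>"
  shows "Digamma (1 - z) - Digamma z = of_real pi * cot (of_real pi * z)"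
proof -
  have z: "z \<notin> \<int>\<^sub>\<le>\<^sub>0" "1 - z \<notin> \<int>\<^sub>\<le>\<^sub>0"
    using assms nonpos_Ints_Int Ints_diff[of 1 "1 - z"] by auto
  have "((\<lambda>z. rGamma z * rGamma (1 - z)) has_field_derivative
          rGamma z * rGamma (1 - z) * (Digamma (1 - z) - Digamma z)) (at z)"
    using z by (auto intro!: derivative_eq_intros simp: algebra_simps)
  moreover have "((\<lambda>z::complex. rGamma z * rGamma (1 - z)) has_field_derivative cos (of_real pi * z)) (at z)"
    unfolding rGamma_reflection_complex by (auto intro!: derivative_eq_intros)
  ultimately have "sin (of_real pi * z) / of_real pi * (Digamma (1 - z) - Digamma z) = cos (of_real pi * z)"
    by (auto dest: DERIV_unique simp: rGamma_reflection_complex)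
  moreover have "sin (of_real pi * z) \<noteq> 0"
    by (rule sin_pi_times_nonzero[OF assms])
  ultimately show ?thesis by (simp add: cot_def field_simps)
qed

lemma Re_cot:
  fixes z :: complex
  assumes "sin z \<noteq> 0"
  shows "Re (cot z) = sin (2 * Re z) / (cosh (2 * Im z) - cos (2 * Re z))"
proof -
  define C S where "C = cosh (Im z)" and "S = sinh (Im z)"
  have CS: "C\<^sup>2 = S\<^sup>2 + 1" unfolding C_def S_def by (rule cosh_square_eq)
  have e: "Re (sin z) = sin (Re z) * C" "Im (sin z) = cos (Re z) * S"
     "Re (cos z) = cos (Re z) * C" "Im (cos z) = - sin (Re z) * S"
    by (simp_all add: Re_sin Im_sin Re_cos Im_cos C_def S_def cosh_field_def sinh_field_def field_simps)
  have "Re (cot z) = (sin (Re z) * cos (Re z) * (C\<^sup>2 - S\<^sup>2)) / ((sin (Re z))\<^sup>2 * C\<^sup>2 + (cos (Re z))\<^sup>2 * S\<^sup>2)"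
    by (simp add: cot_def Re_divide e power2_eq_square algebra_simps)
  also have "(sin (Re z))\<^sup>2 * C\<^sup>2 + (cos (Re z))\<^sup>2 * S\<^sup>2 = (cosh (2 * Im z) - cos (2 * Re z)) / 2"
    unfolding cosh_double cos_double C_def[symmetric] S_def[symmetric] CS
    by (simp add: cos_squared_eq algebra_simps)
  also have "C\<^sup>2 - S\<^sup>2 = 1" using CS by simp
  finally show ?thesis by (simp add: sin_double)
qed

text \<open>In the difference of the limit formulas for \<open>Digamma (1 - z)\<close> and
  \<open>Digamma z\<close> the logarithms cancel, leaving differences of inverses whose real parts
  are Lorentzians.\<close>

lemma poisson_kernel_partial_fractions:
  fixes x t :: real
  assumes x: "0 < x" "x < 1"
  defines "a \<equiv> \<lambda>m. 2 * pi * (real m + x)" and "b \<equiv> \<lambda>m. 2 * pi * (real (Suc m) - x)"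
  shows "(\<lambda>M. 2 * (\<Sum>m<M. lorentz (a m) t - lorentz (b m) t))
           \<longlonglongrightarrow> sin (2 * pi * x) / (cosh t - cos (2 * pi * x))"
proof -
  \<comment> \<open>Chosen so that \<open>2 * pi * z\<close> has real part \<open>2 * pi * x\<close>
    and imaginary part \<open>t\<close>, the arguments that \<open>Re_cot\<close> produces.\<close>
  define z where "z = Complex x (t / (2 * pi))"
  have "z \<notin> \<int>"
  proof
    assume "z \<in> \<int>"
    then obtain n where "z = of_int n" by (elim Ints_cases)
    hence "x = of_int n" by (simp add: z_def complex_eq_iff)
    thus False using x by auto
  qed
  hence nz: "z \<noteq> 0" "1 - z \<noteq> 0" by auto
  have "sin (of_real pi * z) \<noteq> 0"
    by (rule sin_pi_times_nonzero) fact
  hence cot: "Re (cot (of_real pi * z)) = sin (2 * pi * x) / (cosh t - cos (2 * pi * x))"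
    by (simp add: Re_cot z_def mult.assoc)
  have "(\<lambda>m. Re ((of_real (ln (real m)) - (\<Sum>n<m. inverse (1 - z + of_nat n))) -
                 (of_real (ln (real m)) - (\<Sum>n<m. inverse (z + of_nat n)))))
           \<longlonglongrightarrow> Re (Digamma (1 - z) - Digamma z)"
    by (intro tendsto_intros Digamma_LIMSEQ nz)
  also have "Re (Digamma (1 - z) - Digamma z) = pi * (sin (2 * pi * x) / (cosh t - cos (2 * pi * x)))"
    using Digamma_reflection_complex[OF \<open>z \<notin> \<int>\<close>] cot by (metis scaleR_complex.simps(1) scaleR_conv_of_real)
  also have "(\<lambda>m. Re ((of_real (ln (real m)) - (\<Sum>n<m. inverse (1 - z + of_nat n))) -
                 (of_real (ln (real m)) - (\<Sum>n<m. inverse (z + of_nat n))))) =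
             (\<lambda>M. pi * (2 * (\<Sum>m<M. lorentz (a m) t - lorentz (b m) t)))"
  proof
    fix M
    have sc: "u / (u\<^sup>2 + (t / (2 * pi))\<^sup>2) = pi * (2 * (2 * pi * u / (t\<^sup>2 + (2 * pi * u)\<^sup>2)))" for u :: real
    proof -
      have "u\<^sup>2 + (t / (2 * pi))\<^sup>2 = (t\<^sup>2 + (2 * pi * u)\<^sup>2) / (4 * pi\<^sup>2)"
        by (simp add: power_mult_distrib power_divide add_divide_distrib)
      thus ?thesis by (simp add: power2_eq_square)
    qed
    have "Re (inverse (z + of_nat n)) = pi * (2 * lorentz (a n) t)" for n
      using sc[of "real n + x"] by (simp add: z_def a_def lorentz_def add.commute)
    moreover have "Re (inverse (1 - z + of_nat n)) = pi * (2 * lorentz (b n) t)" for n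
      using sc[of "real (Suc n) - x"] by (simp add: z_def b_def lorentz_def algebra_simps)
    ultimately show "Re ((of_real (ln (real M)) - (\<Sum>n<M. inverse (1 - z + of_nat n))) -
                 (of_real (ln (real M)) - (\<Sum>n<M. inverse (z + of_nat n)))) = 
                 pi * (2 * (\<Sum>m<M. lorentz (a m) t - lorentz (b m) t))"
      by (simp add: sum_subtractf sum_distrib_left right_diff_distrib del: inverse_complex.simps complex_Re_of_nat)
  qed
  finally show ?thesis
    by (subst (asm) tendsto_mult_left_iff) auto
qed

text \<open>The interpolation error of \<open>1 / w\<close> is an explicit fraction with numerator
  \<open>x * (1 - x) * r^2\<close>, up to sign, and three linear factors below. Here
  \<open>x * (1 - x) \<le> 1 / 4\<close>, and in the right half-plane moving to the right only
  increases the norm, so each factor is at least \<open>norm w\<close>.\<close>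

lemma linear_interpolation_error_inverse:
  fixes w :: complex and x r :: real
  assumes x: "0 \<le> x" "x \<le> 1" and w: "0 < Re w" and r: "0 \<le> r"
  shows "norm (1 / (w + of_real (x * r)) - (of_real (1 - x) / w + of_real x / (w + of_real r)))
           \<le> r\<^sup>2 / (4 * norm w ^ 3)"
proof -
  have mono: "norm w \<le> norm (w + of_real s)" if "0 \<le> s" for s
    using w that by (auto simp: cmod_def intro!: power_mono)
  have nz: "w \<noteq> 0" "w + of_real s \<noteq> 0" if "0 \<le> s" for s
    using w that by (auto simp: complex_eq_iff)
  have nz': "w \<noteq> 0" "w + of_real (x * r) \<noteq> 0" "w + of_real r \<noteq> 0"
    using r x by (intro nz; simp)+
  have "1 / (w + of_real (x * r)) - (of_real (1 - x) / w + of_real x / (w + of_real r)) =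
          - of_real (x * (1 - x) * r\<^sup>2) / (w * (w + of_real r) * (w + of_real (x * r)))"
    using nz' by (simp add: divide_simps) (simp add: algebra_simps power2_eq_square)
  also have "norm \<dots> = x * (1 - x) * r\<^sup>2 / (norm w * norm (w + of_real r) * norm (w + of_real (x * r)))"
    using x by (simp add: norm_mult norm_divide norm_power del: of_real_mult of_real_diff of_real_power)
  also have "\<dots> \<le> (1 / 4) * r\<^sup>2 / (norm w * norm w * norm w)"
  proof (intro frac_le mult_right_mono mult_mono)
    have "0 \<le> (x - 1 / 2)\<^sup>2" by simp
    thus "x * (1 - x) \<le> 1 / 4" by (simp add: power2_eq_square algebra_simps)
    show "norm w \<le> norm (w + of_real r)" using r by (rule mono)
    show "norm w \<le> norm (w + of_real (x * r))" using r x by (intro mono) auto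
  qed (use nz' in auto)
  finally show ?thesis by (simp add: power3_eq_cube mult.assoc)
qed

text \<open>The points \<open>c + x * r\<close> and \<open>c + (1 - x) * r\<close> lie symmetrically
  in \<open>[c, c + r]\<close>, and the linear interpolants at them differ by exactly the subtracted
  term. What remains is two interpolation errors, each with the factor 1/4.\<close>

lemma lorentz_second_difference:
  assumes x: "0 \<le> x" "x \<le> 1" and c: "0 < c" and r: "0 \<le> r"
  shows "\<bar>lorentz (c + x * r) t - lorentz (c + (1 - x) * r) t
            - (2 * x - 1) * (lorentz (c + r) t - lorentz c t)\<bar> \<le> r\<^sup>2 / (2 * norm (Complex c t) ^ 3)"
proof -
  define w where "w = Complex c t"
  define E where "E = (\<lambda>x. 1 / (w + of_real (x * r)) - (of_real (1 - x) / w + of_real x / (w + of_real r)))"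
  have l: "Re (of_real y / (w + of_real s)) = y * lorentz (c + s) t" for s y
    by (simp add: w_def lorentz_def Re_divide power2_eq_square add_ac)
  have ReE: "Re (E x) = lorentz (c + x * r) t - (1 - x) * lorentz c t - x * lorentz (c + r) t" for x
    using l[of 1 "x * r"] l[of "1 - x" 0] l[of x r] by (simp add: E_def del: of_real_mult of_real_diff Re_divide_of_real)
  have E: "norm (E x) \<le> r\<^sup>2 / (4 * norm w ^ 3)" if "0 \<le> x" "x \<le> 1" for x
    unfolding E_def using that c r by (intro linear_interpolation_error_inverse) (auto simp: w_def)
  have "lorentz (c + x * r) t - lorentz (c + (1 - x) * r) t
            - (2 * x - 1) * (lorentz (c + r) t - lorentz c t) = Re (E x) - Re (E (1 - x))"
    unfolding ReE by (simp add: algebra_simps)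
  also have "\<bar>\<dots>\<bar> \<le> norm (E x) + norm (E (1 - x))"
    using abs_Re_le_cmod[of "E x"] abs_Re_le_cmod[of "E (1 - x)"] by linarith
  also have "\<dots> \<le> r\<^sup>2 / (4 * norm w ^ 3) + r\<^sup>2 / (4 * norm w ^ 3)"
    using x by (intro add_mono E) auto
  finally show ?thesis by (simp add: w_def)
qed

section \<open>Malmsten's integral\<close>

lemma ln_Gamma_series'_real:
  assumes "z > (0::real)" "n > 0"
  shows "ln (Gamma_series' z n) = ln (fact (n - 1)) + z * ln (real n) - (\<Sum>m<n. ln (z + real m))"
proof -
  have "ln (pochhammer z n) = (\<Sum>m<n. ln (z + real m))"
    using assms by (simp add: pochhammer_prod lessThan_atLeast0 ln_prod add_pos_nonneg)
  moreover have "pochhammer z n > 0" using assms by (simp add: pochhammer_pos)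
  ultimately show ?thesis
    using assms by (simp add: Gamma_series'_def ln_div ln_mult)
qed

text \<open>In the difference of the logarithms of \<open>Gamma_series'\<close> at
  \<open>1 - x\<close> and at \<open>x\<close> the factorials cancel, and the powers of
  \<open>n\<close> combine to the exponent \<open>(1 - x) - x\<close>.\<close>

lemma ln_Gamma_reflection_quotient_LIMSEQ:
  fixes x :: real
  assumes x: "0 < x" "x < 1"
  shows "(\<lambda>M. (\<Sum>m<M. ln (real m + x) - ln (real (Suc m) - x)) + (1 - 2 * x) * ln (real M))
           \<longlonglongrightarrow> ln (Gamma (1 - x)) - ln (Gamma x)"
proof (rule Lim_transform_eventually)
  show "(\<lambda>n. ln (Gamma_series' (1 - x) n) - ln (Gamma_series' x n))
           \<longlonglongrightarrow> ln (Gamma (1 - x)) - ln (Gamma x)"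
    using x by (intro tendsto_intros Gamma_series'_LIMSEQ) (auto simp: Gamma_eq_zero_iff)
  show "\<forall>\<^sub>F n in sequentially. ln (Gamma_series' (1 - x) n) - ln (Gamma_series' x n) =
          (\<Sum>m<n. ln (real m + x) - ln (real (Suc m) - x)) + (1 - 2 * x) * ln (real n)"
    using eventually_gt_at_top[of 0]
    by eventually_elim (use x in \<open>simp add: ln_Gamma_series'_real sum_subtractf algebra_simps\<close>)
qed

section \<open>Corrected partial sums of the kernel and dominated convergence\<close>

context
  fixes x :: real
  assumes x: "0 < x" "x < 1"
begin

private definition "a m = 2 * pi * (real m + x)"
private definition "b m = 2 * pi * (real (Suc m) - x)"
text \<open>By linear interpolation the \<open>m\<close>-th term is close to
  \<open>(2 * x - 1)\<close> times the increment of \<open>lorentz\<close> from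
  \<open>2 * pi * m\<close> to \<open>2 * pi * (m + 1)\<close>. These increments telescope, and the
  last summand cancels their total.\<close>

private definition "S M t = (\<Sum>m<M. lorentz (a m) t - lorentz (b m) t) + (1 - 2 * x) * lorentz (2 * pi * real M) t"

private lemma a_pos: "a m > 0" and b_pos: "b m > 0"
  using x by (auto simp: a_def b_def add_nonneg_pos)

private lemma S_LIMSEQ:
  assumes "t > 0"
  shows "(\<lambda>M. 2 * S M t) \<longlonglongrightarrow> sin (2 * pi * x) / (cosh t - cos (2 * pi * x))"
proof -
  have "(\<lambda>M. 2 * (\<Sum>m<M. lorentz (a m) t - lorentz (b m) t))
          \<longlonglongrightarrow> sin (2 * pi * x) / (cosh t - cos (2 * pi * x))"
    unfolding a_def b_def by (rule poisson_kernel_partial_fractions[OF x])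
  moreover have "(\<lambda>M. lorentz (2 * pi * real M) t) \<longlonglongrightarrow> 0"
    unfolding lorentz_def by real_asymp
  hence "(\<lambda>M. 2 * ((1 - 2 * x) * lorentz (2 * pi * real M) t)) \<longlonglongrightarrow> 2 * ((1 - 2 * x) * 0)"
    by (intro tendsto_intros)
  ultimately have "(\<lambda>M. 2 * (\<Sum>m<M. lorentz (a m) t - lorentz (b m) t) + 2 * ((1 - 2 * x) * lorentz (2 * pi * real M) t))
     \<longlonglongrightarrow> sin (2 * pi * x) / (cosh t - cos (2 * pi * x)) + 2 * ((1 - 2 * x) * 0)"
    by (rule tendsto_add)
  thus ?thesis by (simp add: S_def algebra_simps)
qed

text \<open>The constant \<open>ln (2 * pi)\<close> cancels within each pair \<open>a m\<close>,
  \<open>b m\<close>; only the correction term keeps it. The correction also supplies the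
  \<open>ln M\<close> needed in Gauss's product.\<close>

private lemma S_has_integral:
  assumes "M > 0"
  shows "((\<lambda>t. S M t * ln t) has_integral
           pi / 2 * ((\<Sum>m<M. ln (real m + x) - ln (real (Suc m) - x)) + (1 - 2 * x) * ln (real M)
             + (1 - 2 * x) * ln (2 * pi))) {0<..}"
proof -
  have "((\<lambda>t. (\<Sum>m<M. lorentz (a m) t * ln t - lorentz (b m) t * ln t)
               + (1 - 2 * x) * (lorentz (2 * pi * real M) t * ln t)) has_integral
          (\<Sum>m<M. pi / 2 * ln (a m) - pi / 2 * ln (b m))
               + (1 - 2 * x) * (pi / 2 * ln (2 * pi * real M))) {0<..}"
    using assms a_pos b_pos
    by (intro has_integral_add has_integral_sum has_integral_diff has_integral_mult_right
        lorentz_ln_has_integral) auto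
  also have "(\<lambda>t. (\<Sum>m<M. lorentz (a m) t * ln t - lorentz (b m) t * ln t)
               + (1 - 2 * x) * (lorentz (2 * pi * real M) t * ln t)) = (\<lambda>t. S M t * ln t)"
    by (simp add: S_def fun_eq_iff distrib_right sum_distrib_right left_diff_distrib)
  also have "(\<Sum>m<M. pi / 2 * ln (a m) - pi / 2 * ln (b m)) =
               pi / 2 * (\<Sum>m<M. ln (real m + x) - ln (real (Suc m) - x))"
  proof -
    have "ln (a m) = ln (2 * pi) + ln (real m + x)" "ln (b m) = ln (2 * pi) + ln (real (Suc m) - x)" for m
      unfolding a_def b_def using x by (subst ln_mult; simp add: add_nonneg_pos)+
    hence "pi / 2 * ln (a m) - pi / 2 * ln (b m) = pi / 2 * (ln (real m + x) - ln (real (Suc m) - x))" for m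
      by (simp only: right_diff_distrib distrib_left add_diff_add diff_self add_0)
    thus ?thesis by (simp only: sum_distrib_left)
  qed
  also have "ln (2 * pi * real M) = ln (real M) + ln (2 * pi)"
    using assms by (subst ln_mult) auto
  finally have int: "((\<lambda>t. S M t * ln t) has_integral
      pi / 2 * (\<Sum>m<M. ln (real m + x) - ln (real (Suc m) - x))
        + (1 - 2 * x) * (pi / 2 * (ln (real M) + ln (2 * pi)))) {0<..}" .
  have eq: "P * A + y * (P * (B + D)) = P * (A + y * B + y * D)" for P A B D y :: real
    by (simp add: algebra_simps)
  show ?thesis by (rule has_integral_eq_rhs[OF int eq[symmetric]])
qed

private lemma S_step_le:
  assumes t: "t > 0" and m: "m > 0"
  shows "\<bar>S (Suc m) t - S m t\<bar> \<le> 2 * pi\<^sup>2 * real m powr (-3/2) * max 1 t powr (-3/2)"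
proof -
  define c where "c = 2 * pi * real m"
  define N where "N = norm (Complex c t)"
  have "1 * real m \<le> 2 * pi * real m" using pi_ge_two by (intro mult_right_mono) auto
  hence c: "real m \<le> c" by (simp add: c_def)
  moreover have "1 \<le> real m" using m by simp
  ultimately have c1: "1 \<le> c" by linarith
  have N: "c \<le> N" "t \<le> N"
    using c c1 t by (auto simp: N_def cmod_def intro!: real_le_rsqrt)
  \<comment> \<open>\<open>N\<close> dominates both \<open>m\<close> and \<open>max 1 t\<close>;
    sharing its cube evenly gives a factor summable in \<open>m\<close> and one integrable in
    \<open>t\<close> against \<open>ln\<close>.\<close>
  have "real m powr (3/2) * max 1 t powr (3/2) \<le> N powr (3/2) * N powr (3/2)"
    using c c1 N t by (intro mult_mono powr_mono2) auto
  also have "\<dots> = N powr 3" by (simp flip: powr_add)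
  also have "\<dots> = N ^ 3" using N t by simp
  finally have N3: "real m powr (3/2) * max 1 t powr (3/2) \<le> N ^ 3" .
  have "S (Suc m) t - S m t = lorentz (c + x * (2 * pi)) t - lorentz (c + (1 - x) * (2 * pi)) t
            - (2 * x - 1) * (lorentz (c + 2 * pi) t - lorentz c t)"
    by (simp add: S_def a_def b_def c_def algebra_simps)
  also have "\<bar>\<dots>\<bar> \<le> (2 * pi)\<^sup>2 / (2 * N ^ 3)"
    unfolding N_def using x c1 by (intro lorentz_second_difference) auto
  also have "\<dots> \<le> (2 * pi)\<^sup>2 / (2 * (real m powr (3/2) * max 1 t powr (3/2)))"
    using N3 m t N by (intro divide_left_mono mult_left_mono mult_pos_pos) auto
  also have "\<dots> = 2 * pi\<^sup>2 * real m powr (-3/2) * max 1 t powr (-3/2)"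
    by (simp add: powr_minus field_simps)
  finally show ?thesis .
qed

text \<open>Starting from \<open>S 1\<close>, the increments are summed by \<open>S_step_le\<close>;
  the series over \<open>m\<close> converges because 3/2 > 1.\<close>

private lemma S_bounded:
  obtains C where "\<And>M t. M > 0 \<Longrightarrow> t > 0 \<Longrightarrow> \<bar>S M t\<bar> \<le> C * max 1 t powr (-3/2)"
proof -
  define K where "K = (\<Sum>m. real m powr (-3/2))"
  define C0 where "C0 = (a 0 + 1 / a 0) + (b 0 + 1 / b 0) + \<bar>1 - 2 * x\<bar> * (2 * pi + 1 / (2 * pi))"
  have S1: "\<bar>S 1 t\<bar> \<le> C0 * max 1 t powr (-3/2)" if "t > 0" for t
  proof -
    have "\<bar>S 1 t\<bar> \<le> lorentz (a 0) t + lorentz (b 0) t + \<bar>1 - 2 * x\<bar> * lorentz (2 * pi) t"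
      using lorentz_nonneg[of "a 0" t] lorentz_nonneg[of "b 0" t] lorentz_nonneg[of "2 * pi" t] 
        a_pos[of 0] b_pos[of 0]
        abs_triangle_ineq4[of "lorentz (a 0) t" "lorentz (b 0) t"]
        abs_triangle_ineq[of "lorentz (a 0) t - lorentz (b 0) t" "(1 - 2 * x) * lorentz (2 * pi) t"]
      by (simp add: S_def abs_mult)
    also have "\<dots> \<le> (a 0 + 1 / a 0) * max 1 t powr (-3/2) + (b 0 + 1 / b 0) * max 1 t powr (-3/2)
                 + \<bar>1 - 2 * x\<bar> * ((2 * pi + 1 / (2 * pi)) * max 1 t powr (-3/2))"
      using that a_pos b_pos by (intro add_mono mult_left_mono lorentz_le) auto
    also have "\<dots> = C0 * max 1 t powr (-3/2)" by (simp add: C0_def algebra_simps)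
    finally show ?thesis .
  qed
  \<comment> \<open>The summand at \<open>m = 0\<close> is 0, since \<open>0 powr y = 0\<close>, so
    the base case is just the bound on \<open>S 1\<close>.\<close>
  have S: "\<bar>S (Suc M) t\<bar> \<le> (C0 + 2 * pi\<^sup>2 * (\<Sum>m<Suc M. real m powr (-3/2))) * max 1 t powr (-3/2)"
    if "t > 0" for M t
  proof (induction M)
    case 0
    thus ?case using S1[OF that] by simp
  next
    case (Suc M)
    have "\<bar>S (Suc (Suc M)) t\<bar> \<le> \<bar>S (Suc M) t\<bar> + \<bar>S (Suc (Suc M)) t - S (Suc M) t\<bar>" by linarith
    also have "\<dots> \<le> (C0 + 2 * pi\<^sup>2 * (\<Sum>m<Suc M. real m powr (-3/2))) * max 1 t powr (-3/2)
                   + 2 * pi\<^sup>2 * real (Suc M) powr (-3/2) * max 1 t powr (-3/2)"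
      using Suc that by (intro add_mono S_step_le) auto
    also have "\<dots> = (C0 + 2 * pi\<^sup>2 * (\<Sum>m<Suc (Suc M). real m powr (-3/2))) * max 1 t powr (-3/2)"
      by (simp only: sum.lessThan_Suc[of _ "Suc M"]) (simp only: algebra_simps)
    finally show ?case .
  qed
  have K: "(\<Sum>m<M. real m powr (-3/2)) \<le> K" for M
    unfolding K_def by (intro sum_le_suminf) (auto simp: summable_real_powr_iff)
  show ?thesis
  proof
    fix M :: nat and t :: real assume *: "M > 0" "t > 0"
    have "\<bar>S M t\<bar> \<le> (C0 + 2 * pi\<^sup>2 * (\<Sum>m<M. real m powr (-3/2))) * max 1 t powr (-3/2)"
      using S[of t "M - 1"] * by simp
    also have "\<dots> \<le> (C0 + 2 * pi\<^sup>2 * K) * max 1 t powr (-3/2)"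
      using K by (intro mult_right_mono add_left_mono mult_left_mono) auto
    finally show "\<bar>S M t\<bar> \<le> (C0 + 2 * pi\<^sup>2 * K) * max 1 t powr (-3/2)" .
  qed
qed

theorem Malmsten_integral:
  "((\<lambda>t. sin (2 * pi * x) / (cosh t - cos (2 * pi * x)) * ln t) has_integral
      pi * (ln (Gamma (1 - x)) - ln (Gamma x) + (1 - 2 * x) * ln (2 * pi))) {0<..}"
proof -
  obtain C where C: "\<And>M t. M > 0 \<Longrightarrow> t > 0 \<Longrightarrow> \<bar>S M t\<bar> \<le> C * max 1 t powr (-3/2)"
    using S_bounded by blast
  \<comment> \<open>The index is shifted because the integral and the bound for \<open>S M\<close>
    are available for \<open>M > 0\<close>.\<close>
  define f where "f = (\<lambda>k t. 2 * S (Suc k) t * ln t)"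
  define g where "g = (\<lambda>t. sin (2 * pi * x) / (cosh t - cos (2 * pi * x)) * ln t)"
  define I where "I = (\<lambda>M. (\<Sum>m<M. ln (real m + x) - ln (real (Suc m) - x)) + (1 - 2 * x) * ln (real M))"
  have int: "(f k has_integral pi * (I (Suc k) + (1 - 2 * x) * ln (2 * pi))) {0<..}" for k
    using has_integral_mult_right[OF S_has_integral[of "Suc k"], of 2]
    by (simp add: f_def I_def mult.assoc del: sum.lessThan_Suc)
  have "(\<lambda>t::real. max 1 t powr (-3/2) * ln t) absolutely_integrable_on {0<..}"
    by (rule ln_mult_absolutely_integrable[where C = 1]) (auto intro!: continuous_intros)
  hence h: "(\<lambda>t. 2 * C * \<bar>max 1 t powr (-3/2) * ln t\<bar>) integrable_on {0<..}"
    by (intro integrable_on_mult_right) (simp add: absolutely_integrable_on_def)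
  have le: "norm (f k t) \<le> 2 * C * \<bar>max 1 t powr (-3/2) * ln t\<bar>" if "t \<in> {0<..}" for k t
  proof -
    have "2 * \<bar>S (Suc k) t\<bar> * \<bar>ln t\<bar> \<le> 2 * (C * max 1 t powr (-3/2)) * \<bar>ln t\<bar>"
      using that by (intro mult_left_mono mult_right_mono C) auto
    thus ?thesis by (simp add: f_def abs_mult algebra_simps)
  qed
  have lim: "(\<lambda>k. f k t) \<longlonglongrightarrow> g t" if "t \<in> {0<..}" for t
  proof -
    have "(\<lambda>k. 2 * S (Suc k) t) \<longlonglongrightarrow> sin (2 * pi * x) / (cosh t - cos (2 * pi * x))"
      using S_LIMSEQ[of t] that LIMSEQ_Suc by auto
    thus ?thesis unfolding f_def g_def by (intro tendsto_intros)
  qed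
  note dc = dominated_convergence[of f "{0<..}", OF has_integral_integrable[OF int] h le lim]
  have "I \<longlonglongrightarrow> ln (Gamma (1 - x)) - ln (Gamma x)"
    unfolding I_def by (rule ln_Gamma_reflection_quotient_LIMSEQ[OF x])
  hence "(\<lambda>k. pi * (I (Suc k) + (1 - 2 * x) * ln (2 * pi))) \<longlonglongrightarrow>
          pi * (ln (Gamma (1 - x)) - ln (Gamma x) + (1 - 2 * x) * ln (2 * pi))"
    by (intro tendsto_intros LIMSEQ_Suc)
  moreover have "integral {0<..} (f k) = pi * (I (Suc k) + (1 - 2 * x) * ln (2 * pi))" for k
    using int by (rule integral_unique)
  ultimately have "integral {0<..} g = pi * (ln (Gamma (1 - x)) - ln (Gamma x) + (1 - 2 * x) * ln (2 * pi))"
    using LIMSEQ_unique[OF dc(2)] by simp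
  thus ?thesis using dc(1) unfolding g_def by (simp only: has_integral_iff)
qed

end

section \<open>Laplace transform of the logarithm\<close>

text \<open>A mean value bound valid for both signs of \<open>u\<close>; with
  \<open>u = s * ln t\<close> it controls the difference quotients of
  \<open>t powr s\<close>.\<close>

lemma abs_exp_minus_one_le:
  fixes u :: real
  shows "\<bar>exp u - 1\<bar> \<le> \<bar>u\<bar> * max 1 (exp u)"
proof (cases "u \<ge> 0")
  case True
  have "(1 - u) * exp u \<le> exp (- u) * exp u"
    using exp_ge_add_one_self[of "- u"] by (intro mult_right_mono) auto
  also have "\<dots> = 1" by (simp flip: exp_add)
  finally have "exp u - 1 \<le> u * exp u" by (simp add: algebra_simps)
  thus ?thesis using True by (simp add: max.absorb2)
next
  case False
  have "1 + u \<le> exp u" by simp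
  hence "1 - exp u \<le> - u" by linarith
  thus ?thesis using False by (simp add: max.absorb1)
qed

text \<open>The constant is \<open>3 ^ 3\<close>, from cubing
  \<open>t / 3 \<le> exp (t / 3)\<close>.\<close>

lemma exp_minus_mult_max_le:
  fixes t :: real
  assumes "t > 0"
  shows "exp (- t) * max 1 t \<le> 27 * max 1 t powr (-3/2)"
proof (cases "t \<le> 1")
  case True
  thus ?thesis using assms by (simp add: max.absorb1 order.trans[of _ 1])
next
  case False
  have "t ^ 3 / 27 = (t / 3) ^ 3" by (simp add: power_divide)
  also have "\<dots> \<le> exp (t / 3) ^ 3"
    using exp_ge_add_one_self[of "t / 3"] assms by (intro power_mono) linarith+
  also have "\<dots> = exp t" by (simp flip: exp_of_nat_mult)
  finally have "t ^ 3 \<le> 27 * exp t" by simp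
  have "t * t powr (3/2) \<le> t * t ^ 2"
    using False powr_mono[of "3/2" 2 t] by (intro mult_left_mono) auto
  also have "\<dots> = t ^ 3" by (simp add: power2_eq_square power3_eq_cube)
  also note \<open>t ^ 3 \<le> 27 * exp t\<close>
  finally have "t * t powr (3/2) \<le> 27 * exp t" .
  hence "exp (- t) * t \<le> 27 * t powr (-3/2)"
    using assms by (simp add: exp_minus powr_minus field_simps)
  thus ?thesis using False by (simp add: max.absorb2)
qed

lemma exp_minus_ln_absolutely_integrable:
  "(\<lambda>t::real. exp (- t) * ln t) absolutely_integrable_on {0<..}"
proof (rule ln_mult_absolutely_integrable)
  fix t :: real assume t: "t > 0"
  have "exp (- t) * 1 \<le> exp (- t) * max 1 t" by (intro mult_left_mono) auto
  also have "\<dots> \<le> 27 * max 1 t powr (-3/2)" using t by (rule exp_minus_mult_max_le)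
  finally show "\<bar>exp (- t)\<bar> \<le> 27 * max 1 t powr (-3/2)" by simp
qed (auto intro!: continuous_intros)

lemma Gamma_integral_real_Ioi:
  assumes "x > (0::real)"
  shows "((\<lambda>t. t powr (x - 1) * exp (- t)) has_integral Gamma x) {0<..}"
proof -
  have "((\<lambda>t. t powr (x - 1) / exp t) has_integral Gamma x) {0<..}"
    by (rule has_integral_spike_set_eq[THEN iffD1, rotated -1, OF Gamma_integral_real[OF assms]])
      (auto intro: negligible_subset[of "{0}"])
  thus ?thesis by (simp add: exp_minus divide_inverse)
qed

text \<open>Euler's integral is differentiated at \<open>1\<close> along the sequence \<open>1 + 1 / (j + 1)\<close>.\<close>

lemma integral_exp_minus_ln:
  "integral {0<..} (\<lambda>t::real. exp (- t) * ln t) = - euler_mascheroni"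
proof -
  define s where "s = (\<lambda>j. inverse (real (Suc j)))"
  have s: "s j > 0" "s j \<le> 1" for j by (auto simp: s_def inverse_le_1_iff)
  have lim: "filterlim s (at 0) sequentially"
    using LIMSEQ_inverse_real_of_nat s(1) unfolding s_def
    by (auto simp: filterlim_at)
  \<comment> \<open>Integrating these gives the difference quotients of \<open>Gamma\<close> at 1,
    which tend to the derivative \<open>- euler_mascheroni\<close>; pointwise they tend to
    \<open>exp (- t) * ln t\<close>.\<close>
  define f where "f = (\<lambda>j t. exp (- t) * ((t powr s j - 1) / s j))"
  have int: "(f j has_integral (Gamma (1 + s j) - Gamma 1) / s j) {0<..}" for j
  proof -
    have "((\<lambda>t. (t powr (1 + s j - 1) * exp (- t) - t powr (1 - 1) * exp (- t)) / s j) has_integral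
            (Gamma (1 + s j) - Gamma 1) / s j) {0<..}"
      using s[of j] by (intro has_integral_divide has_integral_diff Gamma_integral_real_Ioi) auto
    thus ?thesis
      by (rule has_integral_eq[rotated]) (auto simp: f_def algebra_simps)
  qed
  have h: "(\<lambda>t. 27 * \<bar>max 1 t powr (-3/2) * ln t\<bar>) integrable_on {0::real<..}"
  proof -
    have "(\<lambda>t::real. max 1 t powr (-3/2) * ln t) absolutely_integrable_on {0<..}"
      by (rule ln_mult_absolutely_integrable[where C = 1]) (auto intro!: continuous_intros)
    thus ?thesis by (intro integrable_on_mult_right) (simp add: absolutely_integrable_on_def)
  qed
  have le: "norm (f j t) \<le> 27 * \<bar>max 1 t powr (-3/2) * ln t\<bar>" if "t \<in> {0<..}" for j t
  proof -
    have t: "t > 0" using that by simp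
    \<comment> \<open>As \<open>0 < s j \<le> 1\<close>, this bound is uniform in \<open>j\<close>,
      as the majorant requires.\<close>
    have "t powr s j \<le> max 1 t"
    proof (cases "t \<le> 1")
      case True
      thus ?thesis using t s[of j] by (simp add: powr_le1)
    next
      case False
      thus ?thesis using s[of j] powr_mono[of "s j" 1 t] by simp
    qed
    hence *: "max 1 (exp (s j * ln t)) \<le> max 1 t" using t by (simp add: powr_def)
    have "\<bar>t powr s j - 1\<bar> \<le> \<bar>s j * ln t\<bar> * max 1 (exp (s j * ln t))"
      using abs_exp_minus_one_le[of "s j * ln t"] t by (simp add: powr_def)
    also have "\<dots> \<le> \<bar>s j * ln t\<bar> * max 1 t" using * by (intro mult_left_mono) auto
    finally have "\<bar>t powr s j - 1\<bar> / s j \<le> \<bar>ln t\<bar> * max 1 t"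
      using s[of j] by (simp add: abs_mult field_simps)
    hence "exp (- t) * (\<bar>t powr s j - 1\<bar> / s j) \<le> exp (- t) * (\<bar>ln t\<bar> * max 1 t)"
      by (rule mult_left_mono) simp
    hence "norm (f j t) \<le> exp (- t) * (\<bar>ln t\<bar> * max 1 t)"
      using s(1)[of j] by (simp add: f_def abs_mult)
    also have "\<dots> = (exp (- t) * max 1 t) * \<bar>ln t\<bar>" by simp
    also have "\<dots> \<le> (27 * max 1 t powr (-3/2)) * \<bar>ln t\<bar>"
      using exp_minus_mult_max_le[OF t] by (intro mult_right_mono) auto
    finally show ?thesis by (simp add: abs_mult)
  qed
  have conv: "(\<lambda>j. f j t) \<longlonglongrightarrow> exp (- t) * ln t" if "t \<in> {0<..}" for t
  proof -
    have "((\<lambda>u. t powr u) has_field_derivative ln t) (at 0)"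
      using that by (auto intro!: derivative_eq_intros)
    hence "((\<lambda>h. (t powr h - 1) / h) \<longlongrightarrow> ln t) (at 0)"
      using that by (simp add: DERIV_def)
    from filterlim_compose[OF this lim] show ?thesis
      unfolding f_def by (intro tendsto_intros)
  qed
  have "(\<lambda>j. integral {0<..} (f j)) \<longlonglongrightarrow> integral {0<..} (\<lambda>t::real. exp (- t) * ln t)"
    by (rule dominated_convergence(2)[OF has_integral_integrable[OF int] h le conv])
  moreover have "(\<lambda>j. integral {0<..} (f j)) \<longlonglongrightarrow> - euler_mascheroni"
  proof -
    have "(Gamma has_field_derivative - euler_mascheroni) (at (1::real))"
      by (auto intro!: derivative_eq_intros)
    hence "((\<lambda>h. (Gamma (1 + h) - Gamma 1) / h) \<longlongrightarrow> - euler_mascheroni) (at (0::real))"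
      by (simp only: DERIV_def)
    from filterlim_compose[OF this lim] show ?thesis
      by (simp only: integral_unique[OF int])
  qed
  ultimately show ?thesis by (rule LIMSEQ_unique)
qed

text \<open>Scaling the case \<open>r = 1\<close> gives the integral with
  \<open>ln (r * t) = ln r + ln t\<close>; the \<open>ln r\<close> part is removed by the elementary
  integral of the exponential.\<close>

lemma exp_minus_mult_ln_has_integral:
  fixes r :: real
  assumes r: "r > 0"
  shows "((\<lambda>t. exp (- r * t) * ln t) has_integral - (euler_mascheroni + ln r) / r) {0<..}"
proof -
  let ?f = "\<lambda>t::real. exp (- t) * ln t"
  have "(\<lambda>t. r * ?f (r * t)) absolutely_integrable_on {0<..} \<and>
         integral {0<..} (\<lambda>t. r * ?f (r * t)) = - euler_mascheroni"
    using exp_minus_ln_absolutely_integrable integral_exp_minus_ln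
    by (intro iffD2[OF has_absolute_integral_scale_Ioi[OF r]] conjI)
  hence 1: "((\<lambda>t. r * ?f (r * t)) has_integral - euler_mascheroni) {0<..}"
    by (simp only: has_integral_iff absolutely_integrable_on_def)
  have "((\<lambda>t. exp (- r * t)) has_integral exp (- r * 0) / r) {0<..}"
    by (rule has_integral_spike_set_eq[THEN iffD1, rotated -1, OF has_integral_exp_minus_to_infinity[OF r]])
      (auto intro: negligible_subset[of "{0}"])
  hence 2: "((\<lambda>t. exp (- r * t)) has_integral 1 / r) {0<..}" by simp
  have "((\<lambda>t. (r * ?f (r * t)) / r - exp (- r * t) * ln r) has_integral
           - euler_mascheroni / r - 1 / r * ln r) {0<..}"
    by (intro has_integral_diff has_integral_divide has_integral_mult_left 1 2)
  moreover have "- euler_mascheroni / r - 1 / r * ln r = - (euler_mascheroni + ln r) / r"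
    using r by (simp add: field_simps)
  ultimately have "((\<lambda>t. (r * ?f (r * t)) / r - exp (- r * t) * ln r) has_integral
           - (euler_mascheroni + ln r) / r) {0<..}" by (simp only:)
  thus ?thesis
    by (rule has_integral_eq[rotated]) (use r in \<open>simp add: ln_mult distrib_left add_divide_distrib\<close>)
qed

section \<open>The value at rational arguments\<close>

text \<open>The imaginary part of a finite geometric series with ratio
  \<open>q * cis \<theta>\<close>, cleared of its denominator, the squared modulus of
  \<open>1 - q * cis \<theta>\<close>. The induction uses the three-term recurrence of
  \<open>sin (n * \<theta>)\<close>.\<close>

lemma geometric_sin_sum:
  fixes q \<theta> :: real
  assumes "n > 0"
  shows "(1 - 2 * q * cos \<theta> + q\<^sup>2) * (\<Sum>r = 1..n - 1. q ^ r * sin (real r * \<theta>)) =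
           q * sin \<theta> - q ^ n * sin (real n * \<theta>) + q ^ (n + 1) * sin (real n * \<theta> - \<theta>)"
  using assms
proof (induction n rule: nat_induct_non_zero)
  case 1
  thus ?case by simp
next
  case (Suc n)
  have "sin (real (Suc n) * \<theta>) + sin (real n * \<theta> - \<theta>) = 2 * cos \<theta> * sin (real n * \<theta>)"
    by (simp add: distrib_right sin_add sin_diff)
  hence eq: "sin (real (Suc n) * \<theta>) = 2 * cos \<theta> * sin (real n * \<theta>) - sin (real n * \<theta> - \<theta>)"
    by linarith
  have "{1..Suc n - 1} = insert n {1..n - 1}" using Suc.hyps by auto
  hence "(1 - 2 * q * cos \<theta> + q\<^sup>2) * (\<Sum>r = 1..Suc n - 1. q ^ r * sin (real r * \<theta>)) =
      (1 - 2 * q * cos \<theta> + q\<^sup>2) * (q ^ n * sin (real n * \<theta>)) +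
      (q * sin \<theta> - q ^ n * sin (real n * \<theta>) + q ^ (n + 1) * sin (real n * \<theta> - \<theta>))"
    using Suc by (simp add: distrib_left)
  also have "\<dots> = q * sin \<theta> - q ^ Suc n * sin (real (Suc n) * \<theta>) + q ^ (Suc n + 1) * sin (real n * \<theta>)"
    unfolding eq by (simp add: algebra_simps power2_eq_square)
  finally show ?case by (simp add: distrib_right)
qed

text \<open>With \<open>q = exp (- t)\<close> the cleared denominator is
  \<open>2 * q * (cosh t - cos \<theta>)\<close>, and periodicity reduces the closed form of the sum
  to \<open>q * sin \<theta> * (1 - q ^ n)\<close>.\<close>

lemma conjugate_poisson_kernel_split:
  fixes t \<theta> :: real
  assumes t: "t > 0" and n: "n > 0" and per: "sin (real n * \<theta>) = 0" "cos (real n * \<theta>) = 1"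
  shows "sin \<theta> / (cosh t - cos \<theta>) = 2 * (\<Sum>r = 1..n - 1. exp (- real r * t) * sin (real r * \<theta>))
           + exp (- real n * t) * (sin \<theta> / (cosh t - cos \<theta>))"
proof -
  define q where "q = exp (- t)"
  define D where "D = cosh t - cos \<theta>"
  define A where "A = (\<Sum>r = 1..n - 1. exp (- real r * t) * sin (real r * \<theta>))"
  have qr: "exp (- real r * t) = q ^ r" for r
    by (simp add: q_def flip: exp_of_nat_mult)
  have "cosh t > 1" using t cosh_real_strict_mono[of 0 t] by simp
  hence D: "D > 0" using cos_le_one[of \<theta>] unfolding D_def by linarith
  have q: "q > 0" by (simp add: q_def)
  have "1 - 2 * q * cos \<theta> + q\<^sup>2 = 2 * q * D"
    by (simp add: D_def cosh_field_def q_def exp_minus field_simps power2_eq_square)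
  moreover have "sin (real n * \<theta> - \<theta>) = - sin \<theta>" by (simp add: sin_diff per)
  ultimately have "2 * q * D * A = q * sin \<theta> - q ^ (n + 1) * sin \<theta>"
    using geometric_sin_sum[OF n, of q \<theta>] per unfolding A_def qr by simp
  hence "q * (2 * D * A) = q * (sin \<theta> - q ^ n * sin \<theta>)" by (simp add: algebra_simps)
  hence "2 * D * A = sin \<theta> - q ^ n * sin \<theta>" using q by simp
  hence "sin \<theta> / D = 2 * A + q ^ n * (sin \<theta> / D)" using D by (simp add: field_simps)
  thus ?thesis unfolding D_def A_def qr .
qed

text \<open>Integrability is asserted along with the formula because \<open>integral\<close> takes a
  default value on functions that are not integrable.\<close>

theorem mainTheorem5:
  fixes n k :: nat
  assumes "n \<ge> 2"
    and "k \<in> {1..n - 1}"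
    and "real k \<noteq> real n / 2"
  shows "(\<lambda>x::real. exp (- real n * x) * ln x / (cosh x - cos (2 * pi * real k / real n)))
           integrable_on {0<..}
    \<and> ln (Gamma (real k / real n)) =
        (real n - 2 * real k) * ln (2 * pi) / (2 * real n)
        + 1 / 2 * (ln pi - ln (sin (pi * real k / real n)))
        + 1 / pi * (\<Sum>r = 1..n - 1.
            (euler_mascheroni + ln (real r)) / real r * sin (2 * pi * real r * real k / real n))
        - 1 / (2 * pi) * sin (2 * pi * real k / real n)
          * integral {0<..} (\<lambda>x::real.
              exp (- real n * x) * ln x / (cosh x - cos (2 * pi * real k / real n)))"
proof -
  define x where "x = real k / real n"
  define \<theta> where "\<theta> = 2 * pi * x"
  have n: "n > 0" and k: "k > 0" "k < n" using assms by auto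
  have x: "0 < x" "x < 1" using k by (auto simp: x_def)
  have sin_pos: "sin (pi * x) > 0" using x by (intro sin_gt_zero) auto
  have kx: "real k = real n * x" using n by (simp add: x_def)
  \<comment> \<open>The assumption \<open>k \<noteq> n / 2\<close> enters here: it makes
    \<open>sin \<theta>\<close> nonzero, so the kernel identity can be divided by it to isolate the
    integrand \<open>?f\<close>.\<close>
  have "cos (pi * x) \<noteq> cos (pi / 2)"
  proof
    assume eq: "cos (pi * x) = cos (pi / 2)"
    have "pi * x = pi / 2"
      by (rule cos_inj_pi[OF _ _ _ _ eq]) (use x in auto)
    hence "x = 1 / 2" by simp
    thus False using assms(3) by (simp add: kx)
  qed
  hence "2 * sin (pi * x) * cos (pi * x) \<noteq> 0" using sin_pos by simp
  hence s: "sin \<theta> \<noteq> 0" by (simp add: \<theta>_def mult.assoc sin_double)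
  have n\<theta>: "real n * \<theta> = 2 * pi * real k" by (simp add: \<theta>_def kx)
  have per: "sin (real n * \<theta>) = 0" "cos (real n * \<theta>) = 1"
    unfolding n\<theta> using sin_npi[of "2 * k"] cos_npi[of "2 * k"] by (simp_all add: mult_ac)
  define J where "J = pi * (ln (Gamma (1 - x)) - ln (Gamma x) + (1 - 2 * x) * ln (2 * pi))"
  define T where "T = (\<Sum>r = 1..n - 1. (euler_mascheroni + ln (real r)) / real r * sin (real r * \<theta>))"
  let ?f = "\<lambda>t::real. exp (- real n * t) * ln t / (cosh t - cos \<theta>)"
  have "((\<lambda>t. sin \<theta> / (cosh t - cos \<theta>) * ln t) has_integral J) {0<..}"
    unfolding \<theta>_def J_def by (rule Malmsten_integral[OF x])
  moreover have "((\<lambda>t. 2 * (\<Sum>r = 1..n - 1. exp (- real r * t) * ln t * sin (real r * \<theta>))) has_integral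
      2 * (\<Sum>r = 1..n - 1. - (euler_mascheroni + ln (real r)) / real r * sin (real r * \<theta>))) {0<..}"
    by (intro has_integral_mult_right has_integral_sum has_integral_mult_left
        exp_minus_mult_ln_has_integral) auto
  hence "((\<lambda>t. 2 * (\<Sum>r = 1..n - 1. exp (- real r * t) * ln t * sin (real r * \<theta>))) has_integral - (2 * T)) {0<..}"
    by (simp only: T_def minus_divide_left[symmetric] mult_minus_left mult_minus_right sum_negf)
  ultimately have "((\<lambda>t. sin \<theta> / (cosh t - cos \<theta>) * ln t
      - 2 * (\<Sum>r = 1..n - 1. exp (- real r * t) * ln t * sin (real r * \<theta>))) has_integral J - - (2 * T)) {0<..}"
    by (rule has_integral_diff)
  hence "((\<lambda>t. (sin \<theta> / (cosh t - cos \<theta>) * ln t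
      - 2 * (\<Sum>r = 1..n - 1. exp (- real r * t) * ln t * sin (real r * \<theta>))) / sin \<theta>)
      has_integral (J + 2 * T) / sin \<theta>) {0<..}"
    by (intro has_integral_divide) simp
  hence int: "(?f has_integral (J + 2 * T) / sin \<theta>) {0<..}"
  proof (rule has_integral_eq[rotated])
    fix t :: real assume "t \<in> {0<..}"
    define B where "B = (\<Sum>r = 1..n - 1. exp (- real r * t) * sin (real r * \<theta>))"
    have "sin \<theta> / (cosh t - cos \<theta>) = 2 * B + exp (- real n * t) * (sin \<theta> / (cosh t - cos \<theta>))"
      unfolding B_def using \<open>t \<in> {0<..}\<close> by (intro conjugate_poisson_kernel_split n per) auto
    hence "sin \<theta> / (cosh t - cos \<theta>) * ln t =
             (2 * B + exp (- real n * t) * (sin \<theta> / (cosh t - cos \<theta>))) * ln t"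
      by (rule arg_cong)
    also have "\<dots> = 2 * (B * ln t) + sin \<theta> * ?f t" by (simp add: algebra_simps)
    also have "B * ln t = (\<Sum>r = 1..n - 1. exp (- real r * t) * ln t * sin (real r * \<theta>))"
      unfolding B_def sum_distrib_right by (intro sum.cong) (simp_all only: mult_ac)
    finally show "(sin \<theta> / (cosh t - cos \<theta>) * ln t
      - 2 * (\<Sum>r = 1..n - 1. exp (- real r * t) * ln t * sin (real r * \<theta>))) / sin \<theta> = ?f t"
      using s by simp
  qed
  have "Gamma x * Gamma (1 - x) = pi / sin (pi * x)"
  proof -
    have "Gamma (complex_of_real (1 - x)) = of_real (Gamma (1 - x))" "Gamma (complex_of_real x) = of_real (Gamma x)"
      by (rule Gamma_complex_of_real)+
    moreover have "sin (of_real pi * complex_of_real x) = of_real (sin (pi * x))"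
      by (simp only: of_real_mult[symmetric] sin_of_real)
    ultimately have "complex_of_real (Gamma x * Gamma (1 - x)) = complex_of_real (pi / sin (pi * x))"
      using Gamma_reflection_complex[of "complex_of_real x"]
      by (simp only: of_real_mult of_real_divide of_real_diff of_real_1)
    thus ?thesis by (simp only: of_real_eq_iff)
  qed
  hence "ln (Gamma x * Gamma (1 - x)) = ln (pi / sin (pi * x))" by simp
  \<comment> \<open>Eliminating \<open>Gamma (1 - x)\<close> from \<open>J\<close> doubles
    \<open>ln (Gamma x)\<close> and produces the terms in \<open>ln pi\<close> and
    \<open>ln (sin (pi * x))\<close>.\<close>
  hence Gamma_refl: "ln (Gamma (1 - x)) = ln pi - ln (sin (pi * x)) - ln (Gamma x)"
    using x sin_pos by (simp add: ln_mult ln_div Gamma_real_pos less_imp_neq[THEN not_sym])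
  have I: "integral {0<..} ?f = (J + 2 * T) / sin \<theta>"
    by (rule integral_unique[OF int])
  have "ln (Gamma x) = (real n - 2 * real k) * ln (2 * pi) / (2 * real n)
           + 1 / 2 * (ln pi - ln (sin (pi * x))) + 1 / pi * T - 1 / (2 * pi) * sin \<theta> * integral {0<..} ?f"
  proof -
    have "1 / (2 * pi) * sin \<theta> * integral {0<..} ?f = J / (2 * pi) + 1 / pi * T"
    proof -
      have "1 / (2 * pi) * sin \<theta> * ((J + 2 * T) / sin \<theta>) = (J + 2 * T) / (2 * pi)"
        using s by simp
      thus ?thesis unfolding I by (simp add: add_divide_distrib)
    qed
    moreover have "J / (2 * pi) =
        (ln pi - ln (sin (pi * x)) - 2 * ln (Gamma x) + (1 - 2 * x) * ln (2 * pi)) / 2"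
      unfolding J_def Gamma_refl by simp
    moreover have "(real n - 2 * real k) * ln (2 * pi) / (2 * real n) = (1 - 2 * x) * ln (2 * pi) / 2"
      using n by (simp add: kx field_simps)
    ultimately show ?thesis by (simp add: diff_divide_distrib add_divide_distrib)
  qed
  moreover have "T = (\<Sum>r = 1..n - 1. (euler_mascheroni + ln (real r)) / real r
                          * sin (2 * pi * real r * real k / real n))"
    by (simp add: T_def \<theta>_def x_def mult_ac)
  moreover have "2 * pi * real k / real n = \<theta>" "pi * real k / real n = pi * x" "real k / real n = x"
    by (simp_all add: \<theta>_def x_def)
  ultimately show ?thesis using has_integral_integrable[OF int] by (simp only: simp_thms)
qed

end
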